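(* Let $\Phi=(K_{n,n},\varphi)$ be any $\mathbb{T}$-gain graph on the complete bipartite graph $K_{n,n}$. Then $\mathcal{E}(\Phi)\geq\mathcal{E}(K_{n,n})=2n$, and equality holds if and only if $\Phi\sim(K_{n,n},1)$.
   Context: A $\mathbb{T}$-gain graph $\Phi=(G,\varphi)$ consists of a finite simple graph $G$ and a map $\varphi$ assigning to each orientation $\overrightarrow{e_{p,q}}$ of each edge $v_pv_q$ a value in $\mathbb{T}=\{z\in\mathbb{C}:|z|=1\}$, with $\varphi(\overrightarrow{e_{q,p}})=\varphi(\overrightarrow{e_{p,q}})^{-1}$. Its adjacency matrix $A(\Phi)$ is the Hermitian matrix whose $(p,q)$ entry is $\varphi(\overrightarrow{e_{p,q}})$ if $v_p\sim v_q$ and $0$ otherwise; $\mathcal{E}(\Phi)$ is the sum of absolute values of its eigenvalues, and $\mathcal{E}(G)$ is the usual energy of the (0,1)-adjacency matrix of $G$. $\Phi\sim\Phi'$ means $A(\Phi')=UA(\Phi)U^*$ for a diagonal unitary $U$; $(H,1)$ is the gain graph on $H$ with all gains $1$. *)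

theory Defs
  imports
    "Jordan_Normal_Form.Spectral_Radius"
    "Jordan_Normal_Form.Schur_Decomposition"
    "Graph_Theory.Kuratowski"
begin

text \<open>
  A finite simple graph is a \<^locale>\<open>pair_graph\<close>: each edge is present as its two
  orientations, the arcs \<open>(p, q)\<close> and \<open>(q, p)\<close>. The vertices \<open>v\<^sub>1, \<dots>, v\<^sub>N\<close> are
  numbered \<open>0, \<dots>, N - 1\<close>, so that they index the rows and columns of matrices directly.
\<close>

locale labelled_graph = pair_graph G for G :: "nat pair_pre_digraph" +
  assumes pverts_eq: "pverts G = {..<card (pverts G)}"

text \<open>Only the values of \<open>\<phi>\<close> on the arcs of \<open>G\<close> are relevant.\<close>

locale gain_graph = labelled_graph G for G :: "nat pair_pre_digraph" +
  fixes \<phi> :: "nat \<times> nat \<Rightarrow> complex"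
  assumes gain_unit: "e \<in> parcs G \<Longrightarrow> cmod (\<phi> e) = 1"
    and gain_reverse: "(p, q) \<in> parcs G \<Longrightarrow> \<phi> (q, p) = inverse (\<phi> (p, q))"

definition adjacency_mat :: "nat pair_pre_digraph \<Rightarrow> complex mat" where
  "adjacency_mat G = mat (card (pverts G)) (card (pverts G))
     (\<lambda>(p, q). if (p, q) \<in> parcs G then 1 else 0)"

definition gain_adjacency_mat :: "nat pair_pre_digraph \<Rightarrow> (nat \<times> nat \<Rightarrow> complex) \<Rightarrow> complex mat" where
  "gain_adjacency_mat G \<phi> = mat (card (pverts G)) (card (pverts G))
     (\<lambda>(p, q). if (p, q) \<in> parcs G then \<phi> (p, q) else 0)"

text \<open>The eigenvalues are summed with their (algebraic) multiplicities.\<close>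

definition mat_energy :: "complex mat \<Rightarrow> real" where
  "mat_energy A = (\<Sum>\<mu>\<in>spectrum A. real (order \<mu> (char_poly A)) * cmod \<mu>)"

definition graph_energy :: "nat pair_pre_digraph \<Rightarrow> real" where
  "graph_energy G = mat_energy (adjacency_mat G)"

definition gain_energy :: "nat pair_pre_digraph \<Rightarrow> (nat \<times> nat \<Rightarrow> complex) \<Rightarrow> real" where
  "gain_energy G \<phi> = mat_energy (gain_adjacency_mat G \<phi>)"

definition unitary_mat :: "nat \<Rightarrow> complex mat \<Rightarrow> bool" where
  "unitary_mat N U \<longleftrightarrow> U \<in> carrier_mat N N \<and> U * mat_adjoint U = 1\<^sub>m N \<and> mat_adjoint U * U = 1\<^sub>m N"

definition switching_equivalent ::
  "nat pair_pre_digraph \<times> (nat \<times> nat \<Rightarrow> complex) \<Rightarrow>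
   nat pair_pre_digraph \<times> (nat \<times> nat \<Rightarrow> complex) \<Rightarrow> bool" where
  "switching_equivalent = (\<lambda>(G, \<phi>) (H, \<psi>).
     \<exists>U. unitary_mat (card (pverts G)) U \<and> diagonal_mat U \<and>
         gain_adjacency_mat H \<psi> = U * gain_adjacency_mat G \<phi> * mat_adjoint U)"

lemma (in labelled_graph) gain_graph_one: "gain_graph G (\<lambda>_. 1)"
  by unfold_locales auto

lemma gain_energy_one: "gain_energy G (\<lambda>_. 1) = graph_energy G"
  by (simp add: gain_energy_def graph_energy_def gain_adjacency_mat_def adjacency_mat_def)

lemma (in gain_graph) gain_adjacency_mat_hermitian:
  "mat_adjoint (gain_adjacency_mat G \<phi>) = gain_adjacency_mat G \<phi>"
proof -
  have sym: "(q, p) \<in> parcs G \<longleftrightarrow> (p, q) \<in> parcs G" for p q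
    using pair_sym_arcs by (auto simp: symmetric_def sym_def)
  have cnj: "cnj (\<phi> (q, p)) = \<phi> (p, q)" if pq: "(p, q) \<in> parcs G" for p q
  proof -
    have qp: "(q, p) \<in> parcs G"
      using pq sym by blast
    have "\<phi> (q, p) * cnj (\<phi> (q, p)) = 1"
      using gain_unit[OF qp] by (metis complex_norm_square of_real_1 power_one)
    then have "inverse (\<phi> (q, p)) = cnj (\<phi> (q, p))"
      by (rule inverse_unique)
    then show ?thesis
      using gain_reverse[OF qp] by simp
  qed
  show ?thesis
    by (rule eq_matI)
      (auto simp: gain_adjacency_mat_def mat_adjoint_def mat_of_rows_def sym cnj)
qed

end

theory Submission
  imports Defs
begin

text \<open>
  Each row of \<open>A = A(\<Phi>)\<close> has \<open>n\<close> entries of modulus \<open>1\<close>, so every eigenvalue satisfies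
  \<open>\<bar>\<lambda>\<bar> \<le> n\<close>, while \<open>\<Sum> \<lambda>\<^sup>2 = tr A\<^sup>2 = 2n\<^sup>2\<close>. Hence \<open>n E(\<Phi>) \<ge> \<Sum> \<bar>\<lambda>\<bar>\<^sup>2 \<ge> 2n\<^sup>2\<close>. In case of equality all
  \<open>\<bar>\<lambda>\<bar>\<close> are \<open>0\<close> or \<open>n\<close>, and some eigenvalue \<open>\<mu>\<close> has modulus \<open>n\<close>. At an entry of maximal modulus of
  its eigenvector \<open>v\<close> the triangle inequality is tight, so \<open>\<phi>(p, q) v\<^sub>q = (\<mu>/n) v\<^sub>p\<close> for the neighbours
  \<open>q\<close> of \<open>p\<close>; by connectedness all entries of \<open>v\<close> have the same modulus and this holds on every
  arc. Going back and forth along an arc gives \<open>(\<mu>/n)\<^sup>2 = 1\<close>, and the phases of \<open>v\<close>, with the factor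
  \<open>\<mu>/n\<close> on one side of the bipartition, switch all gains to \<open>1\<close>.
\<close>

section \<open>Energy and trace of the square in terms of a list of eigenvalues\<close>

lemma order_linear_factors:
  fixes es :: "'a :: field list"
  shows "order \<mu> (\<Prod>e\<leftarrow>es. [:- e, 1:]) = count_list es \<mu>"
proof (induction es)
  case (Cons e es)
  have "(\<Prod>e\<leftarrow>e # es. [:- e, 1:]) \<noteq> 0"
    by (auto simp: prod_list_zero_iff simp del: mult_pCons_left)
  then show ?case
    using Cons by (simp add: order_mult order_linear' del: mult_pCons_left)
qed simp

lemma sum_list_map_eq_sum_count_real:
  fixes f :: "'a \<Rightarrow> real"
  shows "(\<Sum>x\<leftarrow>xs. f x) = (\<Sum>x\<in>set xs. real (count_list xs x) * f x)"
proof (induction xs)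
  case (Cons x xs)
  have "(\<Sum>y\<in>set (x # xs). real (count_list (x # xs) y) * f y) =
      (\<Sum>y\<in>set (x # xs). (if y = x then f x else 0) + real (count_list xs y) * f y)"
    by (intro sum.cong) (auto simp: algebra_simps)
  also have "\<dots> = f x + (\<Sum>y\<in>set (x # xs). real (count_list xs y) * f y)"
    by (simp add: sum.distrib)
  \<comment> \<open>If \<open>x\<close> does not occur in \<open>xs\<close>, its count there is 0,
    so the extra index contributes nothing.\<close>
  also have "(\<Sum>y\<in>set (x # xs). real (count_list xs y) * f y) =
      (\<Sum>y\<in>set xs. real (count_list xs y) * f y)"
    by (intro sum.mono_neutral_right) (auto simp: count_list_0_iff)
  finally show ?case
    using Cons by simp
qed simp

text \<open>The order of a root in a product of linear factors is its number of occurrences in the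
  list, so the weights in \<open>mat_energy\<close> turn into repetitions.\<close>

lemma mat_energy_linear_factors:
  assumes A: "A \<in> carrier_mat N N" and cp: "char_poly A = (\<Prod>e\<leftarrow>es. [:- e, 1:])"
  shows "mat_energy A = (\<Sum>e\<leftarrow>es. cmod e)"
proof -
  have "spectrum A = set es"
    unfolding spectrum_root_char_poly[OF A] cp by (auto simp: poly_prod_list prod_list_zero_iff)
  then show ?thesis
    unfolding mat_energy_def cp order_linear_factors by (simp add: sum_list_map_eq_sum_count_real)
qed

lemma sum_diag_mat_mult_commute:
  fixes X Y :: "'a :: comm_semiring_0 mat"
  assumes "X \<in> carrier_mat N N" "Y \<in> carrier_mat N N"
  shows "(\<Sum>i<N. (X * Y) $$ (i, i)) = (\<Sum>i<N. (Y * X) $$ (i, i))"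
proof -
  have "(\<Sum>i<N. (X * Y) $$ (i, i)) = (\<Sum>i<N. \<Sum>j<N. X $$ (i, j) * Y $$ (j, i))"
    using assms by (auto simp: scalar_prod_def atLeast0LessThan intro!: sum.cong)
  also have "\<dots> = (\<Sum>j<N. \<Sum>i<N. Y $$ (j, i) * X $$ (i, j))"
    by (subst sum.swap) (simp add: mult.commute)
  also have "\<dots> = (\<Sum>i<N. (Y * X) $$ (i, i))"
    using assms by (auto simp: scalar_prod_def atLeast0LessThan intro!: sum.cong)
  finally show ?thesis .
qed

text \<open>Both sides are the trace of \<open>A * A\<close>. Schur triangularisation moves it to
  \<open>B * B\<close>, where \<open>B\<close> is triangular with diagonal
  \<open>es\<close>.\<close>

lemma sum_eigenvalue_squares:
  fixes A :: "complex mat"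
  assumes A: "A \<in> carrier_mat N N" and cp: "char_poly A = (\<Prod>e\<leftarrow>es. [:- e, 1:])"
  shows "(\<Sum>e\<leftarrow>es. e\<^sup>2) = (\<Sum>i<N. \<Sum>j<N. A $$ (i, j) * A $$ (j, i))"
proof -
  obtain B P Q where schur: "schur_decomposition A es = (B, P, Q)"
    by (cases "schur_decomposition A es") auto
  have wit: "similar_mat_wit A B P Q" and tri: "upper_triangular B" and diag: "diag_mat B = es"
    using schur_decomposition[OF A cp schur] by auto
  have B: "B \<in> carrier_mat N N" and P: "P \<in> carrier_mat N N" and Q: "Q \<in> carrier_mat N N"
    and QP: "Q * P = 1\<^sub>m N" and AA: "A = P * B * Q"
    using similar_mat_witD2[OF A wit] by auto
  have PBB: "P * B * B \<in> carrier_mat N N"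
    using P B by simp
  have "A * A = P * B * (Q * P) * B * Q"
    unfolding AA using P B Q by (simp add: assoc_mult_mat[of _ N N _ N _ N])
  also have "\<dots> = P * B * B * Q"
    unfolding QP using P B by simp
  finally have sq: "A * A = P * B * B * Q" .
  have "Q * (P * B * B) = (Q * P) * B * B"
    using P B Q by (simp add: assoc_mult_mat[of _ N N _ N _ N])
  then have QBB: "Q * (P * B * B) = B * B"
    unfolding QP using B by simp
  have diag_BB: "(B * B) $$ (i, i) = (B $$ (i, i))\<^sup>2" if i: "i < N" for i
  proof -
    \<comment> \<open>One of the positions (i, j) and (j, i) lies below the diagonal, so only j = i
      survives in the diagonal entry of \<open>B * B\<close>.\<close>
    have "B $$ (i, j) * B $$ (j, i) = 0" if j: "j < N" "j \<noteq> i" for j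
    proof (cases "j < i")
      case True
      then have "B $$ (i, j) = 0"
        using tri B i by (intro upper_triangularD) auto
      then show ?thesis
        by simp
    next
      case False
      then have "B $$ (j, i) = 0"
        using tri B j by (intro upper_triangularD) auto
      then show ?thesis
        by simp
    qed
    then have "(\<Sum>j<N. B $$ (i, j) * B $$ (j, i)) = (\<Sum>j\<in>{i}. B $$ (i, j) * B $$ (j, i))"
      using i by (intro sum.mono_neutral_right) auto
    then show ?thesis
      using B i by (simp add: scalar_prod_def atLeast0LessThan power2_eq_square)
  qed
  have "(\<Sum>i<N. \<Sum>j<N. A $$ (i, j) * A $$ (j, i)) = (\<Sum>i<N. (A * A) $$ (i, i))"
    using A by (auto simp: scalar_prod_def atLeast0LessThan intro!: sum.cong)
  also have "\<dots> = (\<Sum>i<N. (B * B) $$ (i, i))"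
    unfolding sq QBB[symmetric] by (rule sum_diag_mat_mult_commute[OF PBB Q])
  also have "\<dots> = (\<Sum>i<N. (B $$ (i, i))\<^sup>2)"
    using diag_BB by simp
  also have "\<dots> = (\<Sum>e\<leftarrow>es. e\<^sup>2)"
    unfolding diag[symmetric] diag_mat_def using B
    by (simp add: o_def sum_list_distinct_conv_sum_set atLeast0LessThan)
  finally show ?thesis ..
qed

section \<open>Tightness of the triangle inequality and the energy defect\<close>

text \<open>A boundary point of a disc is an extreme point. Projecting onto \<open>c\<close>, every
  term is at most |c|^2 while the average attains it, so each projection is full; the bound on the
  modulus then leaves no room for a component orthogonal to \<open>c\<close>.\<close>

lemma norm_le_eq_average_imp_eq:
  fixes z :: "'a \<Rightarrow> complex"
  assumes S: "finite S" and le: "\<And>q. q \<in> S \<Longrightarrow> cmod (z q) \<le> cmod c"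
    and avg: "(\<Sum>q\<in>S. z q) = of_nat (card S) * c" and q: "q \<in> S"
  shows "z q = c"
proof -
  have re_le: "Re (z p * cnj c) \<le> (cmod c)\<^sup>2" if "p \<in> S" for p
  proof -
    have "Re (z p * cnj c) \<le> cmod (z p) * cmod c"
      using complex_Re_le_cmod[of "z p * cnj c"] by (simp add: norm_mult)
    also have "\<dots> \<le> (cmod c)\<^sup>2"
      using le[OF that] by (simp add: power2_eq_square mult_right_mono)
    finally show ?thesis .
  qed
  have "(\<Sum>p\<in>S. Re (z p * cnj c)) = Re ((\<Sum>p\<in>S. z p) * cnj c)"
    by (simp add: sum_distrib_right)
  also have "\<dots> = (\<Sum>p\<in>S. (cmod c)\<^sup>2)"
    unfolding avg by (simp add: mult.assoc complex_norm_square[symmetric] del: of_real_power)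
  finally have "(\<Sum>p\<in>S. (cmod c)\<^sup>2 - Re (z p * cnj c)) = 0"
    by (simp add: sum_subtractf)
  then have "Re (z q * cnj c) = (cmod c)\<^sup>2"
    using sum_nonneg_eq_0_iff[OF S, of "\<lambda>p. (cmod c)\<^sup>2 - Re (z p * cnj c)"] re_le q by auto
  moreover have "(cmod (z q - c))\<^sup>2 = (cmod (z q))\<^sup>2 - 2 * Re (z q * cnj c) + (cmod c)\<^sup>2"
    by (simp add: cmod_power2 power2_diff algebra_simps)
  moreover have "(cmod (z q))\<^sup>2 \<le> (cmod c)\<^sup>2"
    using le[OF q] by (simp add: power_mono)
  ultimately have "(cmod (z q - c))\<^sup>2 \<le> 0"
    by simp
  then show ?thesis
    by simp
qed

text \<open>The triangle inequality gives 2 n^2 <= sum of |e|^2. Once |e| <= n is known, the terms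
  on the left are nonnegative, so the inequality yields both the energy bound and, at equality, the
  vanishing of every term.\<close>

lemma sum_norm_defect_le:
  fixes es :: "complex list"
  assumes sq: "(\<Sum>e\<leftarrow>es. e\<^sup>2) = 2 * (of_nat n)\<^sup>2"
  shows "(\<Sum>e\<leftarrow>es. cmod e * (n - cmod e)) \<le> n * ((\<Sum>e\<leftarrow>es. cmod e) - 2 * n)"
proof -
  have "2 * (real n)\<^sup>2 = cmod (\<Sum>e\<leftarrow>es. e\<^sup>2)"
    unfolding sq by (simp add: norm_mult norm_power)
  also have "\<dots> \<le> (\<Sum>e\<leftarrow>es. (cmod e)\<^sup>2)"
    by (induction es) (auto simp: norm_power intro: order_trans[OF norm_triangle_ineq])
  finally show ?thesis
    by (simp add: algebra_simps power2_eq_square sum_list_subtractf sum_list_const_mult)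
qed

section \<open>Invariance of the energy under switching\<close>

lemma char_poly_switching_equivalent:
  assumes "switching_equivalent (G, \<phi>) (G, \<psi>)"
  shows "char_poly (gain_adjacency_mat G \<phi>) = char_poly (gain_adjacency_mat G \<psi>)"
proof -
  obtain U where U: "unitary_mat (card (pverts G)) U"
    and eq: "gain_adjacency_mat G \<psi> = U * gain_adjacency_mat G \<phi> * mat_adjoint U"
    using assms by (auto simp: switching_equivalent_def)
  have "mat_adjoint U \<in> carrier_mat (card (pverts G)) (card (pverts G))"
    using U by (auto simp: unitary_mat_def mat_adjoint_def)
  then have "similar_mat_wit (gain_adjacency_mat G \<psi>) (gain_adjacency_mat G \<phi>) U (mat_adjoint U)"
    using U eq unfolding similar_mat_wit_def
    by (auto simp: unitary_mat_def Let_def gain_adjacency_mat_def)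
  then show ?thesis
    by (metis char_poly_similar similar_mat_def)
qed

text \<open>The characteristic polynomial determines both the spectrum and the multiplicities, hence
  the energy.\<close>

lemma gain_energy_switching_equivalent:
  assumes "switching_equivalent (G, \<phi>) (G, \<psi>)"
  shows "gain_energy G \<phi> = gain_energy G \<psi>"
proof -
  have "gain_adjacency_mat G \<chi> \<in> carrier_mat (card (pverts G)) (card (pverts G))" for \<chi>
    by (simp add: gain_adjacency_mat_def)
  then show ?thesis
    using char_poly_switching_equivalent[OF assms]
    by (simp add: gain_energy_def mat_energy_def spectrum_root_char_poly[of _ "card (pverts G)"])
qed

section \<open>Rows and trace for a gain graph on the complete bipartite graph\<close>

text \<open>The parts are arbitrary sets of vertex numbers, so the matrix need not be in block
  form.\<close>

locale balanced_bipartite_gain_graph = gain_graph +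
  fixes n :: nat and U V :: "nat set"
  assumes verts_eq: "pverts G = U \<union> V" and disjoint: "U \<inter> V = {}"
    and card_U: "card U = n" and card_V: "card V = n"
    and arcs_eq: "parcs G = U \<times> V \<union> V \<times> U"
begin

abbreviation "A \<equiv> gain_adjacency_mat G \<phi>"

lemma finite_parts: "finite U" "finite V"
  using pair_finite_verts verts_eq by auto

lemma card_verts: "card (pverts G) = 2 * n"
  using card_Un_disjoint[OF finite_parts disjoint] by (simp add: verts_eq card_U card_V)

lemma verts_lessThan: "{..<2 * n} = U \<union> V"
  using pverts_eq card_verts verts_eq by simp

lemma A_carrier: "A \<in> carrier_mat (2 * n) (2 * n)"
  by (simp add: gain_adjacency_mat_def card_verts)

lemma A_index: "i < 2 * n \<Longrightarrow> j < 2 * n \<Longrightarrow>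
    A $$ (i, j) = (if (i, j) \<in> parcs G then \<phi> (i, j) else 0)"
  by (simp add: gain_adjacency_mat_def card_verts)

text \<open>A number that is no vertex is sent to \<open>U\<close> as well; thus
  \<open>card_nbrs\<close> holds for all \<open>p\<close>, while \<open>arc_iff\<close> asks for a
  vertex.\<close>

definition nbrs :: "nat \<Rightarrow> nat set" where
  "nbrs p = (if p \<in> U then V else U)"

lemma card_nbrs: "card (nbrs p) = n" and finite_nbrs: "finite (nbrs p)"
  by (simp_all add: nbrs_def card_U card_V finite_parts)

lemma arc_iff: "p < 2 * n \<Longrightarrow> (p, q) \<in> parcs G \<longleftrightarrow> q \<in> nbrs p"
  using verts_lessThan disjoint by (auto simp: nbrs_def arcs_eq)

lemma nbrs_less: "q \<in> nbrs p \<Longrightarrow> q < 2 * n"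
  using verts_lessThan by (auto simp: nbrs_def split: if_splits)

lemma arc_sym: "(p, q) \<in> parcs G \<Longrightarrow> (q, p) \<in> parcs G"
  by (auto simp: arcs_eq)

lemma A_row_sum:
  assumes p: "p < 2 * n"
  shows "(\<Sum>q<2 * n. A $$ (p, q) * f q) = (\<Sum>q\<in>nbrs p. \<phi> (p, q) * f q)"
proof -
  have "(\<Sum>q<2 * n. A $$ (p, q) * f q) = (\<Sum>q\<in>nbrs p. A $$ (p, q) * f q)"
    using p by (intro sum.mono_neutral_right) (auto simp: A_index arc_iff nbrs_less)
  also have "\<dots> = (\<Sum>q\<in>nbrs p. \<phi> (p, q) * f q)"
    using p by (intro sum.cong) (auto simp: A_index arc_iff nbrs_less)
  finally show ?thesis .
qed

text \<open>The two gains of an edge multiply to 1, so each of the 2n rows contributes its degree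
  n.\<close>

lemma sum_entry_products: "(\<Sum>i<2 * n. \<Sum>j<2 * n. A $$ (i, j) * A $$ (j, i)) = 2 * (of_nat n)\<^sup>2"
proof -
  have "(\<Sum>j<2 * n. A $$ (i, j) * A $$ (j, i)) = of_nat n" if i: "i < 2 * n" for i
  proof -
    have "\<phi> (i, j) * A $$ (j, i) = 1" if j: "j \<in> nbrs i" for j
    proof -
      have arc: "(i, j) \<in> parcs G"
        using i j by (simp add: arc_iff)
      have "\<phi> (i, j) \<noteq> 0"
        using gain_unit[OF arc] by auto
      then show ?thesis
        using gain_reverse[OF arc] arc_sym[OF arc] i nbrs_less[OF j] by (simp add: A_index)
    qed
    then show ?thesis
      using A_row_sum[OF i, of "\<lambda>j. A $$ (j, i)"] by (simp add: card_nbrs)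
  qed
  then show ?thesis
    by (simp add: power2_eq_square)
qed

section \<open>Eigenvalues of maximal modulus\<close>

lemma eigenvector_row:
  assumes ev: "eigenvector A v \<mu>" and p: "p < 2 * n"
  shows "(\<Sum>q\<in>nbrs p. \<phi> (p, q) * v $ q) = \<mu> * v $ p"
proof -
  have v: "v \<in> carrier_vec (2 * n)" and eq: "A *\<^sub>v v = \<mu> \<cdot>\<^sub>v v"
    using ev A_carrier by (auto simp: eigenvector_def)
  have "(\<Sum>q\<in>nbrs p. \<phi> (p, q) * v $ q) = (A *\<^sub>v v) $ p"
    unfolding A_row_sum[OF p, symmetric]
    using v p A_carrier by (simp add: scalar_prod_def atLeast0LessThan)
  then show ?thesis
    unfolding eq using v p by simp
qed

lemma eigenvector_max_entry:
  assumes ev: "eigenvector A v \<mu>"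
  obtains p where "p < 2 * n" "v $ p \<noteq> 0" "\<And>q. q < 2 * n \<Longrightarrow> cmod (v $ q) \<le> cmod (v $ p)"
proof -
  have v: "v \<in> carrier_vec (2 * n)" and v0: "v \<noteq> 0\<^sub>v (2 * n)"
    using ev A_carrier by (auto simp: eigenvector_def)
  obtain r where r: "r < 2 * n" "v $ r \<noteq> 0"
    using v v0 by (metis carrier_vecD dim_vec eq_vecI index_zero_vec(1) index_zero_vec(2))
  define S where "S = (\<lambda>q. cmod (v $ q)) ` {..<2 * n}"
  have "Max S \<in> S"
    using r(1) by (intro Max_in) (auto simp: S_def)
  then obtain p where p: "p < 2 * n" "Max S = cmod (v $ p)"
    by (auto simp: S_def)
  have p_max: "cmod (v $ q) \<le> cmod (v $ p)" if "q < 2 * n" for q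
    unfolding p(2)[symmetric] using that by (intro Max_ge) (auto simp: S_def)
  have "v $ p \<noteq> 0"
    using p_max[OF r(1)] r(2) by auto
  with p(1) p_max that show ?thesis
    by blast
qed

text \<open>In the row of a largest entry of an eigenvector, n entries that are no larger,
  multiplied by unit gains, sum to \<mu> times that entry.\<close>

lemma cmod_eigenvalue_le:
  assumes "eigenvalue A \<mu>"
  shows "cmod \<mu> \<le> n"
proof -
  obtain v where ev: "eigenvector A v \<mu>"
    using assms by (auto simp: eigenvalue_def)
  obtain p where p: "p < 2 * n" "v $ p \<noteq> 0"
    and max: "\<And>q. q < 2 * n \<Longrightarrow> cmod (v $ q) \<le> cmod (v $ p)"
    using eigenvector_max_entry[OF ev] by blast
  have "cmod (\<mu> * v $ p) \<le> (\<Sum>q\<in>nbrs p. cmod (v $ p))"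
    unfolding eigenvector_row[OF ev p(1), symmetric]
    using p gain_unit by (intro sum_norm_le) (simp add: norm_mult arc_iff max nbrs_less)
  then show ?thesis
    using p by (simp add: norm_mult card_nbrs)
qed

text \<open>The eigenvalue equation says that (\<mu>/n) v_p is the average of the terms \<phi>(p, q)
  v_q, none of which exceeds it in modulus; so all of them coincide with it.\<close>

lemma peripheral_eigenvector:
  assumes ev: "eigenvector A v \<mu>" and \<mu>: "cmod \<mu> = n"
    and p: "p < 2 * n" and max: "\<And>q. q < 2 * n \<Longrightarrow> cmod (v $ q) \<le> cmod (v $ p)"
    and arc: "(p, q) \<in> parcs G"
  shows "\<phi> (p, q) * v $ q = \<mu> / n * v $ p"
proof -
  have q: "q \<in> nbrs p"
    using p arc by (simp add: arc_iff)
  then have n: "n > 0"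
    using card_nbrs finite_nbrs by (metis card_gt_0_iff empty_iff)
  show ?thesis
  proof (rule norm_le_eq_average_imp_eq[OF finite_nbrs _ _ q])
    fix q assume "q \<in> nbrs p"
    then show "cmod (\<phi> (p, q) * v $ q) \<le> cmod (\<mu> / n * v $ p)"
      using p n \<mu> gain_unit by (simp add: norm_mult norm_divide arc_iff max nbrs_less)
  qed (use n in \<open>simp add: eigenvector_row[OF ev p] card_nbrs\<close>)
qed

lemma peripheral_eigenvalue_imp_switching_one:
  assumes "eigenvalue A \<mu>" and \<mu>: "cmod \<mu> = n"
  shows "switching_equivalent (G, \<phi>) (G, \<lambda>_. 1)"
proof -
  obtain v where ev: "eigenvector A v \<mu>"
    using assms by (auto simp: eigenvalue_def)
  obtain m where m: "m < 2 * n" "v $ m \<noteq> 0"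
    and max: "\<And>q. q < 2 * n \<Longrightarrow> cmod (v $ q) \<le> cmod (v $ m)"
    using eigenvector_max_entry[OF ev] by blast
  define M where "M = cmod (v $ m)"
  define \<epsilon> where "\<epsilon> = \<mu> / n"
  have M: "M > 0"
    using m by (simp add: M_def)
  have \<epsilon>1: "cmod \<epsilon> = 1"
    using m(1) \<mu> by (simp add: \<epsilon>_def norm_divide)
  have step: "\<phi> (p, q) * v $ q = \<epsilon> * v $ p" if "p < 2 * n" "cmod (v $ p) = M" "(p, q) \<in> parcs G" for p q
    unfolding \<epsilon>_def using that max by (intro peripheral_eigenvector[OF ev \<mu>]) (auto simp: M_def)
  have spread: "cmod (v $ q) = M" if "p < 2 * n" "cmod (v $ p) = M" "(p, q) \<in> parcs G" for p q
    using arg_cong[OF step[OF that], of cmod] that gain_unit \<epsilon>1 by (simp add: norm_mult)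
  have const: "cmod (v $ p) = M" if p: "p < 2 * n" for p
  proof (cases "p \<in> nbrs m")
    case True
    then show ?thesis
      using spread[OF m(1), of p] arc_iff[OF m(1)] by (simp add: M_def)
  next
    case False
    \<comment> \<open>Here \<open>p\<close> lies in the same part as \<open>m\<close>, so it is
      reached in two steps through any neighbour \<open>q\<close> of \<open>m\<close>.\<close>
    have "nbrs m \<noteq> {}"
      using m(1) card_nbrs[of m] by auto
    then obtain q where q: "q \<in> nbrs m"
      by blast
    have "(q, p) \<in> parcs G"
      using False p q verts_lessThan disjoint by (auto simp: nbrs_def arcs_eq split: if_splits)
    moreover have "cmod (v $ q) = M"
      using spread[OF m(1), of q] arc_iff[OF m(1)] q by (simp add: M_def)
    ultimately show ?thesis
      using spread nbrs_less[OF q] by blast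
  qed
  have arc_less: "p < 2 * n" "q < 2 * n" if "(p, q) \<in> parcs G" for p q
    using that verts_lessThan by (auto simp: arcs_eq)
  have gain_step: "\<phi> (p, q) * v $ q = \<epsilon> * v $ p" if "(p, q) \<in> parcs G" for p q
    using that arc_less const step by blast
  \<comment> \<open>Going from \<open>m\<close> to a neighbour and back cancels the gains, and each
    passage yields one factor \<epsilon>. Hence \<epsilon> is 1 or -1, the latter for \<mu> =
    -n.\<close>
  have \<epsilon>_sq: "\<epsilon> * \<epsilon> = 1"
  proof -
    obtain q where "q \<in> nbrs m"
      using m(1) card_nbrs[of m] by fastforce
    then have arc: "(m, q) \<in> parcs G"
      using m by (simp add: arc_iff)
    have "\<phi> (m, q) \<noteq> 0"
      using gain_unit[OF arc] by auto
    then have "v $ m = \<phi> (m, q) * (\<phi> (q, m) * v $ m)"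
      using gain_reverse[OF arc] by simp
    also have "\<dots> = \<epsilon> * \<epsilon> * v $ m"
      unfolding gain_step[OF arc_sym[OF arc]] using gain_step[OF arc] by (simp add: mult.left_commute)
    finally show ?thesis
      using m(2) by simp
  qed
  have cnj_\<epsilon>: "cnj \<epsilon> = \<epsilon>"
    using \<epsilon>_sq by (auto simp: square_eq_1_iff)
  \<comment> \<open>Conjugate phases of \<open>v\<close> alone turn every gain into \<epsilon>.
    Exactly one end of an arc lies outside \<open>U\<close>, so the extra factor there makes this
    \<epsilon>^2 = 1; dividing by \<open>M\<close> normalises the modulus.\<close>
  define u where "u p = (if p \<in> U then 1 else \<epsilon>) * cnj (v $ p) / M" for p
  have vv: "cnj (v $ p) * v $ p = M * M" if "p < 2 * n" for p
    using const[OF that] complex_norm_square[of "v $ p"] by (simp add: power2_eq_square mult.commute)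
  have u_unit: "u p * cnj (u p) = 1" if "p < 2 * n" for p
    using vv[OF that] M \<epsilon>_sq by (auto simp: u_def cnj_\<epsilon> field_simps)
  have u_gain: "u p * \<phi> (p, q) * cnj (u q) = 1" if arc: "(p, q) \<in> parcs G" for p q
  proof -
    have "cnj (v $ p) * (\<phi> (p, q) * v $ q) = \<epsilon> * (M * M)"
      unfolding gain_step[OF arc] using vv[OF arc_less(1)[OF arc]] by (simp add: mult.left_commute)
    moreover have "p \<in> U \<longleftrightarrow> q \<notin> U"
      using arc disjoint by (auto simp: arcs_eq)
    ultimately show ?thesis
      using M \<epsilon>_sq by (auto simp: u_def cnj_\<epsilon> field_simps)
  qed
  have adj: "mat_adjoint (mat_diag (2 * n) u) = mat_diag (2 * n) (\<lambda>i. cnj (u i))"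
    by (rule eq_matI) (auto simp: mat_diag_def mat_adjoint_def mat_of_rows_def)
  have one: "mat_diag (2 * n) f = 1\<^sub>m (2 * n)" if "\<And>i. i < 2 * n \<Longrightarrow> f i = (1 :: complex)" for f
    using that by (auto simp: mat_diag_def)
  have "unitary_mat (2 * n) (mat_diag (2 * n) u)"
    unfolding unitary_mat_def adj by (auto intro!: one simp: u_unit mult.commute[of "cnj _"])
  moreover have "diagonal_mat (mat_diag (2 * n) u)"
    by (simp add: diagonal_mat_def mat_diag_def)
  moreover have "gain_adjacency_mat G (\<lambda>_. 1) = mat_diag (2 * n) u * A * mat_adjoint (mat_diag (2 * n) u)"
    unfolding adj mat_diag_mult_left[OF A_carrier]
    by (subst mat_diag_mult_right[of _ "2 * n"])
      (auto simp: gain_adjacency_mat_def card_verts u_gain)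
  ultimately show ?thesis
    unfolding switching_equivalent_def using card_verts by auto
qed

section \<open>The lower bound and the case of equality\<close>

text \<open>Complex characteristic polynomials split, so one list of roots with repetition carries
  the energy and the trace of the square together.\<close>

lemma eigenvalue_list:
  obtains es where "set es = spectrum A" "length es = 2 * n"
    "gain_energy G \<phi> = (\<Sum>e\<leftarrow>es. cmod e)" "(\<Sum>e\<leftarrow>es. e\<^sup>2) = 2 * (of_nat n)\<^sup>2"
proof -
  obtain es where cp: "char_poly A = (\<Prod>e\<leftarrow>es. [:- e, 1:])" and len: "length es = 2 * n"
    using char_poly_factorized[OF A_carrier] by blast
  have "set es = spectrum A"
    unfolding spectrum_root_char_poly[OF A_carrier] cp by (auto simp: poly_prod_list prod_list_zero_iff)
  with len show ?thesis
    using mat_energy_linear_factors[OF A_carrier cp] sum_eigenvalue_squares[OF A_carrier cp]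
    by (intro that) (auto simp: gain_energy_def sum_entry_products)
qed

lemma gain_energy_ge: "gain_energy G \<phi> \<ge> 2 * n"
proof -
  obtain es where es: "set es = spectrum A" "length es = 2 * n" "gain_energy G \<phi> = (\<Sum>e\<leftarrow>es. cmod e)"
    and sq: "(\<Sum>e\<leftarrow>es. e\<^sup>2) = 2 * (of_nat n)\<^sup>2"
    using eigenvalue_list by metis
  have "0 \<le> (\<Sum>e\<leftarrow>es. cmod e * (n - cmod e))"
    using es(1) cmod_eigenvalue_le by (intro sum_list_nonneg) (auto simp: spectrum_def)
  with sum_norm_defect_le[OF sq] have "0 \<le> real n * (gain_energy G \<phi> - 2 * n)"
    unfolding es(3) by simp
  then show ?thesis
    \<comment> \<open>For n = 0 the factor n cannot be cancelled, but then \<open>es\<close> has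
      length 0 and the energy is 0.\<close>
    using es by (cases "n = 0") (auto simp: zero_le_mult_iff)
qed

lemma gain_energy_minimal_imp_switching_one:
  assumes min: "gain_energy G \<phi> = 2 * n"
  shows "switching_equivalent (G, \<phi>) (G, \<lambda>_. 1)"
proof (cases "n = 0")
  case True
  then show ?thesis
    unfolding switching_equivalent_def
    by (auto intro!: exI[of _ "1\<^sub>m 0"]
        simp: unitary_mat_def diagonal_mat_def gain_adjacency_mat_def card_verts mat_adjoint_def)
next
  case False
  obtain es where es: "set es = spectrum A" and energy: "gain_energy G \<phi> = (\<Sum>e\<leftarrow>es. cmod e)"
    and sq: "(\<Sum>e\<leftarrow>es. e\<^sup>2) = 2 * (of_nat n)\<^sup>2"
    using eigenvalue_list by metis
  have nonneg: "0 \<le> cmod e * (n - cmod e)" if "e \<in> set es" for e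
    using that es cmod_eigenvalue_le by (auto simp: spectrum_def)
  have zero: "cmod e * (n - cmod e) = 0" if "e \<in> set es" for e
  proof -
    \<comment> \<open>A single nonnegative term is squeezed between 0 and the whole sum, whose bound
      is 0 when the energy is 2n.\<close>
    have "cmod e * (n - cmod e) \<le> (\<Sum>e\<leftarrow>es. cmod e * (n - cmod e))"
      using nonneg that by (intro member_le_sum_list) auto
    then show ?thesis
      using sum_norm_defect_le[OF sq] nonneg[OF that]
      unfolding energy[symmetric] min by (intro antisym) simp_all
  qed
  have "\<exists>e\<in>set es. e \<noteq> 0"
  proof (rule ccontr)
    assume "\<not> (\<exists>e\<in>set es. e \<noteq> 0)"
    then have "(\<Sum>e\<leftarrow>es. e\<^sup>2) = 0"
      by (intro sum_list_neutral) auto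
    with sq False show False
      by simp
  qed
  then obtain \<mu> where "\<mu> \<in> set es" "\<mu> \<noteq> 0"
    by blast
  \<comment> \<open>A nonzero root of x (n - x) is n, so |\<mu>| = n.\<close>
  with zero[of \<mu>] es show ?thesis
    by (intro peripheral_eigenvalue_imp_switching_one[of \<mu>]) (auto simp: spectrum_def)
qed

section \<open>Energy of the graph itself\<close>

lemma eigenvalue_all_one:
  assumes one: "\<And>e. e \<in> parcs G \<Longrightarrow> \<phi> e = 1" and ev: "eigenvalue A \<mu>" and "\<mu> \<noteq> 0"
  shows "\<mu>\<^sup>2 = (of_nat n)\<^sup>2"
proof -
  \<comment> \<open>A nonzero eigenvalue makes \<open>v\<close> constant on either part, since \<open>\<mu> v\<^sub>p\<close> is the sum over the other part.\<close>
  obtain v where v: "eigenvector A v \<mu>"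
    using ev by (auto simp: eigenvalue_def)
  define a where "a = (\<Sum>q\<in>U. v $ q)"
  define b where "b = (\<Sum>q\<in>V. v $ q)"
  have row: "(\<Sum>q\<in>nbrs p. v $ q) = \<mu> * v $ p" if p: "p < 2 * n" for p
  proof -
    have "(\<Sum>q\<in>nbrs p. v $ q) = (\<Sum>q\<in>nbrs p. \<phi> (p, q) * v $ q)"
      using p one by (intro sum.cong) (auto simp: arc_iff)
    then show ?thesis
      using eigenvector_row[OF v p] by simp
  qed
  have rU: "\<mu> * v $ p = b" if "p \<in> U" for p
  proof -
    have "nbrs p = V" "p < 2 * n"
      using that verts_lessThan by (auto simp: nbrs_def)
    then show ?thesis
      using row[of p] by (simp add: b_def)
  qed
  have rV: "\<mu> * v $ p = a" if "p \<in> V" for p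
  proof -
    have "nbrs p = U" "p < 2 * n"
      using that verts_lessThan disjoint by (auto simp: nbrs_def)
    then show ?thesis
      using row[of p] by (simp add: a_def)
  qed
  \<comment> \<open>Summing the rows over each part gives a 2 by 2 system for the part sums: \<mu>
    swaps them up to the factor n, so \<mu>^2 acts as n^2.\<close>
  have "\<mu> * a = (\<Sum>p\<in>U. b)"
    unfolding a_def sum_distrib_left by (intro sum.cong) (simp_all add: rU)
  then have a: "\<mu> * a = of_nat n * b"
    by (simp add: card_U)
  have "\<mu> * b = (\<Sum>p\<in>V. a)"
    unfolding b_def sum_distrib_left by (intro sum.cong) (simp_all add: rV)
  then have b: "\<mu> * b = of_nat n * a"
    by (simp add: card_V)
  obtain p where p: "p \<in> U \<union> V" "v $ p \<noteq> 0"
    using eigenvector_max_entry[OF v] verts_lessThan by (metis lessThan_iff)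
  then have "a \<noteq> 0 \<or> b \<noteq> 0"
    using rU[of p] rV[of p] \<open>\<mu> \<noteq> 0\<close> by auto
  moreover have "\<mu>\<^sup>2 * a = (of_nat n)\<^sup>2 * a" "\<mu>\<^sup>2 * b = (of_nat n)\<^sup>2 * b"
    unfolding power2_eq_square mult.assoc a b by (simp_all only: mult.left_commute[of \<mu>] a b)
  ultimately show ?thesis
    by auto
qed

text \<open>Every eigenvalue satisfies e^2 = n |e|, being 0 or a square root of n^2. Summation gives
  n E = 2 n^2 without computing multiplicities.\<close>

lemma gain_energy_all_one:
  assumes one: "\<And>e. e \<in> parcs G \<Longrightarrow> \<phi> e = 1"
  shows "gain_energy G \<phi> = 2 * n"
proof -
  obtain es where es: "set es = spectrum A" "length es = 2 * n" "gain_energy G \<phi> = (\<Sum>e\<leftarrow>es. cmod e)"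
    and sq: "(\<Sum>e\<leftarrow>es. e\<^sup>2) = 2 * (of_nat n)\<^sup>2"
    using eigenvalue_list by metis
  have "e\<^sup>2 = of_nat n * of_real (cmod e)" if "e \<in> set es" for e
  proof (cases "e = 0")
    case False
    then have "e\<^sup>2 = (of_nat n)\<^sup>2"
      using eigenvalue_all_one[OF one] that es by (auto simp: spectrum_def)
    moreover from this have "cmod e = n"
      by (metis norm_ge_zero norm_of_nat norm_power of_nat_0_le_iff power2_eq_iff_nonneg)
    ultimately show ?thesis
      by (simp add: power2_eq_square)
  qed simp
  then have "(\<Sum>e\<leftarrow>es. e\<^sup>2) = (\<Sum>e\<leftarrow>es. of_nat n * of_real (cmod e))"
    by (metis (mono_tags, lifting) map_eq_conv)
  also have "\<dots> = of_real (n * gain_energy G \<phi>)"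
    unfolding es(3) by (induction es) (auto simp: algebra_simps)
  finally have "complex_of_real (n * gain_energy G \<phi>) = of_real (2 * (real n)\<^sup>2)"
    using sq by simp
  then have "n * gain_energy G \<phi> = 2 * (real n)\<^sup>2"
    by (simp only: of_real_eq_iff)
  then show ?thesis
    using es by (cases "n = 0") (auto simp: power2_eq_square)
qed

end

theorem theorem3p10:
  fixes n :: nat
    and G :: "nat pair_pre_digraph"
    and \<phi> :: "nat \<times> nat \<Rightarrow> complex"
  assumes "complete_bipartite_digraph n n (with_proj G)"
    and "gain_graph G \<phi>"
  shows "gain_energy G \<phi> \<ge> graph_energy G \<and>
    graph_energy G = 2 * real n \<and>
    (gain_energy G \<phi> = graph_energy G \<longleftrightarrow> switching_equivalent (G, \<phi>) (G, \<lambda>_. 1))"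
proof -
  obtain U V where parts: "pverts G = U \<union> V" "U \<inter> V = {}" "card U = n" "card V = n"
    "parcs G = U \<times> V \<union> V \<times> U"
    using assms(1) by (auto simp: complete_bipartite_digraph_pair_def)
  interpret \<Phi>: gain_graph G \<phi>
    by (rule assms(2))
  interpret \<Phi>: balanced_bipartite_gain_graph G \<phi> n U V
    by unfold_locales (use parts in auto)
  \<comment> \<open>The plain graph is treated as the gain graph with all gains 1, so the same
    locale supplies its energy.\<close>
  interpret one: gain_graph G "\<lambda>_. 1"
    by (rule \<Phi>.gain_graph_one)
  interpret one: balanced_bipartite_gain_graph G "\<lambda>_. 1" n U V
    by unfold_locales (use parts in auto)
  have energy_one: "graph_energy G = 2 * real n"
    unfolding gain_energy_one[symmetric] using one.gain_energy_all_one by simp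
  moreover have "switching_equivalent (G, \<phi>) (G, \<lambda>_. 1) \<Longrightarrow> gain_energy G \<phi> = graph_energy G"
    unfolding gain_energy_one[symmetric] by (rule gain_energy_switching_equivalent)
  ultimately show ?thesis
    using \<Phi>.gain_energy_ge \<Phi>.gain_energy_minimal_imp_switching_one by auto
qed

end
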